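(* Let $I_0$ be an interval and let $\{f_k\}_{k\ge0}$ be a $C^1$-uniformly equicontinuous and $C^1$-uniformly bounded sequence of $C^1$ maps $f_k:I_0\to I_0$ with $p=\sup_k\#\mathcal{C}_k<\infty$. Suppose there is $\lambda>0$ such that $$\liminf_{n\to\infty}\frac1n\log|Df^n(x)|>2\lambda$$ for all $x$ in a set $H\subset I_0$. Then there exists $c>0$ such that $$\liminf_{n\to\infty}\frac1n\sum_{i=1}^n r_i(\{f_k\},x)\ge c$$ for Lebesgue almost every $x\in H$.
   Context: $\mathcal{C}_k$ denotes the set of critical points of $f_k$ (possibly empty). $f^i=f_{i-1}\circ\cdots\circ f_1\circ f_0$ for $i\ge1$ and $f^0=\mathrm{id}$. For $i\in\mathbb{N}$ and $x\in I_0$: $T_i(\{f_k\},x)$ is the maximal interval contained in $I_0$ and containing $x$ such that $f^j(T_i(x))\cap\mathcal{C}_j=\emptyset$ for $0\le j<i$; $L_i(x),R_i(x)$ are the connected components of $T_i(x)\setminus\{x\}$; and $r_i(\{f_k\},x)=\min\{|f^i(L_i(x))|,|f^i(R_i(x))|\}$ ($|\cdot|$ = length). The sequence is $C^1$-uniformly equicontinuous if for every $\zeta>0$ there is $\varepsilon>0$ such that $|x-y|<\varepsilon$ implies $|f_k(x)-f_k(y)|<\zeta$ and $|Df_k(x)-Df_k(y)|<\zeta$ for all $k$; it is $C^1$-uniformly bounded if there is $\Gamma>0$ with $|f_k(x)|,|Df_k(x)|\le\Gamma$ for all $x\in I_0$ and all $k$. *)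

theory Defs
  imports "HOL-Analysis.Analysis"
begin

fun itr :: "(nat \<Rightarrow> real \<Rightarrow> real) \<Rightarrow> nat \<Rightarrow> real \<Rightarrow> real" where
  "itr f 0 = id"
| "itr f (Suc i) = f i \<circ> itr f i"

text \<open>Derivative of the n-th iterate (chain rule), Df k being the derivative of f k.\<close>
definition Dn :: "(nat \<Rightarrow> real \<Rightarrow> real) \<Rightarrow> (nat \<Rightarrow> real \<Rightarrow> real) \<Rightarrow> nat \<Rightarrow> real \<Rightarrow> real" where
  "Dn f Df n x = (\<Prod>j<n. Df j (itr f j x))"

definition crit :: "real set \<Rightarrow> (nat \<Rightarrow> real \<Rightarrow> real) \<Rightarrow> nat \<Rightarrow> real set" where
  "crit I0 Df k = {x \<in> I0. Df k x = 0}"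

definition Tset :: "real set \<Rightarrow> (nat \<Rightarrow> real \<Rightarrow> real) \<Rightarrow> (nat \<Rightarrow> real \<Rightarrow> real) \<Rightarrow> nat \<Rightarrow> real \<Rightarrow> real set" where
  "Tset I0 f Df i x = connected_component_set
      {y \<in> I0. \<forall>j<i. itr f j y \<notin> crit I0 Df j} x"

definition Lset :: "real set \<Rightarrow> (nat \<Rightarrow> real \<Rightarrow> real) \<Rightarrow> (nat \<Rightarrow> real \<Rightarrow> real) \<Rightarrow> nat \<Rightarrow> real \<Rightarrow> real set" where
  "Lset I0 f Df i x = {y \<in> Tset I0 f Df i x. y < x}"

definition Rset :: "real set \<Rightarrow> (nat \<Rightarrow> real \<Rightarrow> real) \<Rightarrow> (nat \<Rightarrow> real \<Rightarrow> real) \<Rightarrow> nat \<Rightarrow> real \<Rightarrow> real set" where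
  "Rset I0 f Df i x = {y \<in> Tset I0 f Df i x. x < y}"

definition len :: "real set \<Rightarrow> real" where
  "len S = measure lebesgue S"

definition rr :: "real set \<Rightarrow> (nat \<Rightarrow> real \<Rightarrow> real) \<Rightarrow> (nat \<Rightarrow> real \<Rightarrow> real) \<Rightarrow> nat \<Rightarrow> real \<Rightarrow> real" where
  "rr I0 f Df i x = min (len (itr f i ` Lset I0 f Df i x)) (len (itr f i ` Rset I0 f Df i x))"

end

theory Submission
  imports Defs
begin

text \<open>Fix a block length \<open>N\<close> and a time \<open>n = q N\<close>. A point \<open>x\<close> with \<open>\<bar>Df\<^sup>n x\<bar> \<ge> exp (2 \<lambda> n)\<close> and
  \<open>\<Sum>r\<^sub>i < c n\<close> lies in a monotonicity branch of \<open>f\<^sup>n\<close>, and each branch contributes at most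
  \<open>2 \<Gamma> exp (- 2 \<lambda> n)\<close> to the measure of the set of all such points, so it suffices to bound the number
  of branches involved by a constant times \<open>exp (\<lambda> n)\<close>. Over a block of \<open>N\<close> steps a branch splits into
  at most \<open>(p + 1)\<^sup>N\<close> pieces. If \<open>x\<close> is \<open>\<sigma>\<close>-close to an end of its branch when the block starts and
  stays away from the critical points during the block, then equicontinuity leaves only two pieces, one for
  each end. The other blocks are rare: each of them has a time with \<open>\<bar>Df\<^sub>j\<bar> < \<zeta>\<close>, which the expansion
  allows for a small proportion of times only, or it starts with \<open>r\<^sub>i \<ge> \<sigma>\<close>, which is rare because
  \<open>\<Sum>r\<^sub>i\<close> is small. The Borel--Cantelli lemma along the multiples of \<open>N\<close> concludes.\<close>

section \<open>Lengths of images and the measure of expanding sets on the line\<close>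

text \<open>The intermediate value theorem puts every value between \<open>g a\<close> and
  \<open>g b\<close>, other than \<open>g b\<close>, into the image. The endpoint \<open>b\<close>
  is left out because \<open>Lset\<close> and \<open>Rset\<close> omit their base point; this
  changes the length by a null set only.\<close>

lemma abs_diff_le_measure_image:
  fixes g :: "real \<Rightarrow> real"
  assumes cont: "continuous_on (closed_segment a b) g"
    and sub: "closed_segment a b - {b} \<subseteq> L"
    and L: "g ` L \<in> lmeasurable"
  shows "\<bar>g a - g b\<bar> \<le> measure lebesgue (g ` L)"
proof -
  let ?J = "closed_segment (g a) (g b)"
  have "?J - {g b} \<subseteq> g ` L"
  proof
    fix y assume y: "y \<in> ?J - {g b}"
    then obtain x where "x \<in> closed_segment a b" "g x = y"
      using IVT'_closed_segment_real[of y g a b] cont by blast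
    with y sub show "y \<in> g ` L" by blast
  qed
  moreover have "?J - {g b} \<in> sets lebesgue"
    by (intro sets.Diff) (auto simp: closed_segment_eq_real_ivl)
  ultimately have "measure lebesgue (?J - {g b}) \<le> measure lebesgue (g ` L)"
    using L by (intro measure_mono_fmeasurable) auto
  moreover have "measure lebesgue (?J - {g b}) = measure lebesgue ?J"
    by (rule measure_Diff_null_set) (auto simp: closed_segment_eq_real_ivl)
  moreover have "measure lebesgue ?J = \<bar>g a - g b\<bar>"
    by (auto simp: closed_segment_eq_real_ivl)
  ultimately show ?thesis by simp
qed

lemma measure_expanding_set_le:
  fixes g g' :: "real \<Rightarrow> real"
  assumes T: "connected T"
    and der: "\<And>x. x \<in> T \<Longrightarrow> (g has_real_derivative g' x) (at x within T)"
    and cont: "continuous_on T g'"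
    and inj: "inj_on g T"
    and bd: "\<And>x. x \<in> T \<Longrightarrow> \<bar>g x\<bar> \<le> B"
    and B: "B \<ge> 0" and K: "K > 0"
  defines "A \<equiv> {x \<in> T. K \<le> \<bar>g' x\<bar>}"
  shows "A \<in> lmeasurable" and "measure lebesgue A \<le> 2 * B / K"
proof -
  have Tm: "T \<in> sets lebesgue"
    using T real_interval_borel_measurable is_interval_connected_1 by fastforce
  have "(\<lambda>x. \<bar>g' x\<bar>) \<in> borel_measurable (lebesgue_on T)"
    by (intro continuous_imp_measurable_on_sets_lebesgue continuous_intros cont Tm)
  then have "{x \<in> space (lebesgue_on T). K \<le> \<bar>g' x\<bar>} \<in> sets (lebesgue_on T)"
    by measurable
  then have A: "A \<in> sets lebesgue"
    using Tm by (simp add: A_def sets_restrict_space_iff)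
  have AT: "A \<subseteq> T" by (auto simp: A_def)
  have derA: "(g has_real_derivative g' x) (at x within A)" if "x \<in> A" for x
    using der[of x] that AT by (auto intro: DERIV_subset)
  have "g ` A \<in> sets lebesgue"
    by (intro differentiable_image_in_sets_lebesgue A)
       (auto simp: differentiable_on_def real_differentiable_def intro: derA)
  moreover have gA: "g ` A \<subseteq> {-B..B}"
    using bd AT by (force simp: abs_le_iff)
  ultimately have gAm: "g ` A \<in> lmeasurable"
    by (meson bounded_closed_interval bounded_subset bounded_set_imp_lmeasurable)
  then have one: "(\<lambda>_. 1::real) absolutely_integrable_on (g ` A)"
    by (simp add: absolutely_integrable_on_iff_nonneg lmeasurable_iff_integrable_on)
  have change: "(\<lambda>x. \<bar>g' x\<bar> * 1) absolutely_integrable_on A \<and>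
      integral A (\<lambda>x. \<bar>g' x\<bar> * 1) = integral (g ` A) (\<lambda>_. 1)"
    using has_absolute_integral_change_of_variables_1'[OF A derA inj_on_subset[OF inj AT],
        of "\<lambda>_. 1" "integral (g ` A) (\<lambda>_. 1)"] one by blast
  then have int: "(\<lambda>x. \<bar>g' x\<bar>) integrable_on A"
    using absolutely_integrable_on_def by auto
  \<comment> \<open>\<open>T\<close> may be unbounded, so finiteness of the measure of
    \<open>A\<close> has to be derived: the constant \<open>K\<close> is dominated on
    \<open>A\<close> by the integrable \<open>\<bar>g' x\<bar>\<close>.\<close>
  have "(\<lambda>_. K) absolutely_integrable_on A"
  proof (rule measurable_bounded_by_integrable_imp_absolutely_integrable[OF _ A int])
    show "norm K \<le> \<bar>g' x\<bar>" if "x \<in> A" for x using that K by (auto simp: A_def)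
  qed auto
  then have Kint: "(\<lambda>_. K) integrable_on A"
    using absolutely_integrable_on_def by blast
  then have "(\<lambda>x. (1 / K) * K) integrable_on A"
    using integrable_on_mult_right by blast
  then show Am: "A \<in> lmeasurable"
    using K by (simp add: lmeasurable_iff_integrable_on)
  have "K * measure lebesgue A = integral A (\<lambda>_. K)"
    using lmeasure_integral[OF Am] integral_mult_right[of A K "\<lambda>_. 1"] by simp
  also have "\<dots> \<le> integral A (\<lambda>x. \<bar>g' x\<bar>)"
    by (rule integral_le[OF Kint int]) (auto simp: A_def)
  also have "\<dots> = measure lebesgue (g ` A)"
    using change lmeasure_integral[OF gAm] by simp
  also have "\<dots> \<le> measure lebesgue {-B..B}"
    using gA gAm by (intro measure_mono_fmeasurable) auto
  also have "\<dots> = 2 * B" using B by simp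
  finally show "measure lebesgue A \<le> 2 * B / K"
    using K by (simp add: field_simps)
qed

section \<open>Iterates of the sequence and their monotonicity branches\<close>

locale nonautonomous_C1_maps =
  fixes I0 :: "real set" and f Df :: "nat \<Rightarrow> real \<Rightarrow> real" and \<Gamma> :: real and p :: nat
  assumes interval: "is_interval I0"
    and maps: "\<And>k x. x \<in> I0 \<Longrightarrow> f k x \<in> I0"
    and deriv: "\<And>k x. x \<in> I0 \<Longrightarrow> (f k has_real_derivative Df k x) (at x within I0)"
    and C1: "\<And>k. continuous_on I0 (Df k)"
    and f_bound: "\<And>k x. x \<in> I0 \<Longrightarrow> \<bar>f k x\<bar> \<le> \<Gamma>"
    and Df_bound: "\<And>k x. x \<in> I0 \<Longrightarrow> \<bar>Df k x\<bar> \<le> \<Gamma>"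
    and \<Gamma>_gt_1: "\<Gamma> > 1"
    and finite_crit: "\<And>k. finite (crit I0 Df k)"
    and card_crit: "\<And>k. card (crit I0 Df k) \<le> p"
begin

definition noncrit :: "nat \<Rightarrow> real set" where
  "noncrit m = {y \<in> I0. \<forall>j<m. itr f j y \<notin> crit I0 Df j}"

abbreviation branch :: "nat \<Rightarrow> real \<Rightarrow> real set" where
  "branch m \<equiv> Tset I0 f Df m"

lemma branch_eq_component: "branch m x = connected_component_set (noncrit m) x"
  by (simp add: Tset_def noncrit_def)

lemma itr_in [simp]: "x \<in> I0 \<Longrightarrow> itr f n x \<in> I0"
  by (induction n) (auto simp: maps)

text \<open>Time 0 is excluded because \<open>itr f 0\<close> is the identity and \<open>I0\<close>
  may be unbounded. The condition \<open>0 < m\<close> in later lemmas has the same origin.\<close>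

lemma abs_itr_le: "x \<in> I0 \<Longrightarrow> 0 < n \<Longrightarrow> \<bar>itr f n x\<bar> \<le> \<Gamma>"
  by (cases n) (auto simp: f_bound)

lemma Dn_0 [simp]: "Dn f Df 0 x = 1"
  and Dn_Suc: "Dn f Df (Suc n) x = Df n (itr f n x) * Dn f Df n x"
  by (simp_all add: Dn_def)

lemma itr_deriv:
  assumes "x \<in> I0"
  shows "(itr f n has_real_derivative Dn f Df n x) (at x within I0)"
proof (induction n)
  case 0
  then show ?case by (simp add: id_def)
next
  case (Suc n)
  have "(f n has_real_derivative Df n (itr f n x)) (at (itr f n x) within itr f n ` I0)"
    by (rule DERIV_subset[OF deriv]) (auto simp: assms)
  from DERIV_image_chain[OF this Suc] show ?case
    by (simp add: Dn_Suc o_def)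
qed

lemma continuous_on_itr: "continuous_on I0 (itr f n)"
  using itr_deriv DERIV_continuous_on by blast

lemma continuous_on_Dn: "continuous_on I0 (Dn f Df n)"
  unfolding Dn_def
  by (intro continuous_on_prod continuous_on_compose2[OF C1 continuous_on_itr]) auto

text \<open>A product vanishes iff one of its factors does, so the points removed up to time
  \<open>m\<close> are the zeros of the derivative of \<open>itr f m\<close>.\<close>

lemma noncrit_iff: "x \<in> noncrit m \<longleftrightarrow> x \<in> I0 \<and> Dn f Df m x \<noteq> 0"
  by (auto simp: noncrit_def crit_def Dn_def)

lemma noncrit_subset: "noncrit m \<subseteq> I0"
  by (auto simp: noncrit_def)

lemma noncrit_Suc: "noncrit (Suc m) = {x \<in> noncrit m. itr f m x \<notin> crit I0 Df m}"
  by (auto simp: noncrit_def less_Suc_eq)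

lemma noncrit_antimono: "m \<le> n \<Longrightarrow> noncrit n \<subseteq> noncrit m"
  by (auto simp: noncrit_def)

lemma branch_subset: "branch m x \<subseteq> noncrit m"
  unfolding branch_eq_component by (rule connected_component_subset)

lemma branch_subset_I0: "branch m x \<subseteq> I0"
  using branch_subset noncrit_subset by blast

lemma connected_branch: "connected (branch m x)"
  unfolding branch_eq_component by (rule connected_connected_component)

lemma self_in_branch: "x \<in> noncrit m \<Longrightarrow> x \<in> branch m x"
  unfolding branch_eq_component by simp

lemma closed_segment_subset_branch:
  "a \<in> branch m x \<Longrightarrow> b \<in> branch m x \<Longrightarrow> closed_segment a b \<subseteq> branch m x"
  by (intro closed_segment_subset) (auto simp: is_interval_connected_1 connected_branch simp flip: is_interval_convex_1)

lemma branch_eqI: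
  assumes "closed_segment x y \<subseteq> noncrit m"
  shows "branch m x = branch m y"
proof -
  have "closed_segment x y \<subseteq> connected_component_set (noncrit m) x"
    by (rule connected_component_maximal) (use assms in auto)
  then have "y \<in> connected_component_set (noncrit m) x" by auto
  from connected_component_eq[OF this] show ?thesis by (simp add: branch_eq_component)
qed

text \<open>Rolle: two points of a branch with the same image would enclose a zero of
  \<open>Dn f Df m\<close>, and the segment between them stays in the branch.\<close>

lemma inj_on_itr_branch: "inj_on (itr f m) (branch m x)"
proof (rule linorder_inj_onI)
  fix a b assume ab: "a < b" "a \<in> branch m x" "b \<in> branch m x"
  show "itr f m a \<noteq> itr f m b"
  proof
    assume eq: "itr f m a = itr f m b"
    have sub: "{a..b} \<subseteq> branch m x"
      using closed_segment_subset_branch[OF ab(2,3)] ab(1) by (simp add: closed_segment_eq_real_ivl)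
    have der: "(itr f m has_derivative (*) (Dn f Df m y)) (at y)" if "a < y" "y < b" for y
    proof -
      have "{a<..<b} \<subseteq> I0" using sub branch_subset_I0 by fastforce
      then have "(itr f m has_real_derivative Dn f Df m y) (at y within {a<..<b})"
        using that by (intro DERIV_subset[OF itr_deriv]) auto
      moreover have "at y within {a<..<b} = at y"
        using that by (intro at_within_open) auto
      ultimately show ?thesis by (simp add: has_field_derivative_def)
    qed
    have "continuous_on {a..b} (itr f m)"
      by (rule continuous_on_subset[OF continuous_on_itr order_trans[OF sub branch_subset_I0]])
    from Rolle_deriv[OF ab(1) eq this der] obtain z where
      "a < z" "z < b" "(*) (Dn f Df m z) = (\<lambda>v. 0)" by blast
    from this(3) have "Dn f Df m z = 0" by (metis mult.right_neutral)
    moreover have "z \<in> branch m x" using sub \<open>a < z\<close> \<open>z < b\<close> by auto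
    ultimately show False
      using branch_subset noncrit_iff by blast
  qed
qed auto

lemma measure_branch_expanding:
  fixes m :: nat and x K :: real
  assumes m: "0 < m" and K: "K > 0"
  defines "A \<equiv> {y \<in> branch m x. K \<le> \<bar>Dn f Df m y\<bar>}"
  shows "A \<in> lmeasurable" and "measure lebesgue A \<le> 2 * \<Gamma> / K"
proof -
  have der: "(itr f m has_real_derivative Dn f Df m y) (at y within branch m x)"
    if "y \<in> branch m x" for y
    using that branch_subset_I0 by (blast intro: DERIV_subset itr_deriv)
  have cont: "continuous_on (branch m x) (Dn f Df m)"
    by (rule continuous_on_subset[OF continuous_on_Dn branch_subset_I0])
  have bd: "\<bar>itr f m y\<bar> \<le> \<Gamma>" if "y \<in> branch m x" for y
    using that branch_subset_I0 m by (blast intro: abs_itr_le)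
  note * = measure_expanding_set_le[OF connected_branch der cont inj_on_itr_branch bd _ K]
  show "A \<in> lmeasurable" "measure lebesgue A \<le> 2 * \<Gamma> / K"
    unfolding A_def using * \<Gamma>_gt_1 by simp_all
qed

lemma itr_lipschitz:
  assumes "x \<in> I0" "y \<in> I0"
  shows "\<bar>itr f (m + k) x - itr f (m + k) y\<bar> \<le> \<Gamma> ^ k * \<bar>itr f m x - itr f m y\<bar>"
proof (induction k)
  case (Suc k)
  have "\<bar>itr f (m + Suc k) x - itr f (m + Suc k) y\<bar>
      \<le> \<Gamma> * \<bar>itr f (m + k) x - itr f (m + k) y\<bar>"
    using field_differentiable_bound[of I0 "f (m + k)" "Df (m + k)" \<Gamma>] assms deriv Df_bound interval
    by (simp add: is_interval_convex)
  also have "\<dots> \<le> \<Gamma> * (\<Gamma> ^ k * \<bar>itr f m x - itr f m y\<bar>)"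
    using Suc \<Gamma>_gt_1 by (intro mult_left_mono) auto
  finally show ?case by (simp add: mult.assoc)
qed simp

lemma itr_image_lmeasurable:
  assumes "0 < m" "connected S" "S \<subseteq> I0"
  shows "itr f m ` S \<in> lmeasurable"
proof (rule measurable_convex)
  show "convex (itr f m ` S)"
    using assms(2) connected_continuous_image[OF continuous_on_subset[OF continuous_on_itr assms(3)]]
    by (meson is_interval_connected_1 is_interval_convex_1)
  have "itr f m ` S \<subseteq> {-\<Gamma>..\<Gamma>}"
  proof (rule image_subsetI)
    fix y assume "y \<in> S"
    then have "\<bar>itr f m y\<bar> \<le> \<Gamma>" using assms by (intro abs_itr_le) auto
    then show "itr f m y \<in> {-\<Gamma>..\<Gamma>}" by (simp add: abs_le_iff)
  qed
  then show "bounded (itr f m ` S)"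
    using bounded_closed_interval bounded_subset by blast
qed

lemma connected_halves:
  "connected (Lset I0 f Df m x)" "connected (Rset I0 f Df m x)"
proof -
  have *: "is_interval (branch m x)" by (simp add: is_interval_connected_1 connected_branch)
  have "is_interval (branch m x \<inter> {..<x})" "is_interval (branch m x \<inter> {x<..})"
    by (intro is_interval_Int *; simp add: is_interval_1)+
  moreover have "Lset I0 f Df m x = branch m x \<inter> {..<x}" "Rset I0 f Df m x = branch m x \<inter> {x<..}"
    by (auto simp: Lset_def Rset_def)
  ultimately show "connected (Lset I0 f Df m x)" "connected (Rset I0 f Df m x)"
    by (simp_all add: is_interval_connected_1)
qed

text \<open>This is how \<open>rr\<close> enters the counting: if \<open>rr\<close> is below
  \<open>\<sigma>\<close> at \<open>y\<close>, then at time \<open>m\<close> the whole part of the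
  branch on one side of \<open>y\<close> has image within \<open>\<sigma>\<close> of the image of
  \<open>y\<close>.\<close>

lemma itr_dist_le_len:
  assumes m: "0 < m" and y: "y \<in> noncrit m" and z: "z \<in> branch m y"
  shows "z < y \<Longrightarrow> \<bar>itr f m z - itr f m y\<bar> \<le> len (itr f m ` Lset I0 f Df m y)"
    and "y < z \<Longrightarrow> \<bar>itr f m z - itr f m y\<bar> \<le> len (itr f m ` Rset I0 f Df m y)"
proof -
  have sub: "closed_segment z y \<subseteq> branch m y"
    using closed_segment_subset_branch z self_in_branch y by blast
  have cont: "continuous_on (closed_segment z y) (itr f m)"
    by (rule continuous_on_subset[OF continuous_on_itr order_trans[OF sub branch_subset_I0]])
  have LR: "Lset I0 f Df m y \<subseteq> I0" "Rset I0 f Df m y \<subseteq> I0"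
    using branch_subset_I0 by (auto simp: Lset_def Rset_def)
  show "\<bar>itr f m z - itr f m y\<bar> \<le> len (itr f m ` Lset I0 f Df m y)" if "z < y"
  proof -
    have "closed_segment z y - {y} \<subseteq> {..<y}"
      using that by (auto simp: closed_segment_eq_real_ivl1)
    then have "closed_segment z y - {y} \<subseteq> Lset I0 f Df m y"
      using sub by (auto simp: Lset_def)
    from abs_diff_le_measure_image[OF cont this itr_image_lmeasurable[OF m connected_halves(1) LR(1)]]
    show ?thesis by (simp add: len_def)
  qed
  show "\<bar>itr f m z - itr f m y\<bar> \<le> len (itr f m ` Rset I0 f Df m y)" if "y < z"
  proof -
    have "closed_segment y z - {y} \<subseteq> {y<..}"
      using that by (auto simp: closed_segment_eq_real_ivl1)
    then have "closed_segment z y - {y} \<subseteq> Rset I0 f Df m y"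
      using sub by (auto simp: Rset_def closed_segment_commute[of z])
    from abs_diff_le_measure_image[OF cont this itr_image_lmeasurable[OF m connected_halves(2) LR(2)]]
    show ?thesis by (simp add: len_def)
  qed
qed

lemma rr_nonneg: "0 \<le> rr I0 f Df i x"
  by (simp add: rr_def len_def)

end

section \<open>Counting branches\<close>

text \<open>The value \<open>g' x\<close> is a function of the pair \<open>(g x, h x)\<close>. In
  the applications \<open>g\<close> and \<open>g'\<close> give the branch before and after some
  steps, and the code \<open>h\<close> tells which piece of the old branch contains
  \<open>x\<close>.\<close>

lemma card_image_le_mult_codes:
  assumes fin: "finite (g ` A)" "finite C"
    and h: "\<And>x. x \<in> A \<Longrightarrow> h x \<in> C"
    and det: "\<And>x y. x \<in> A \<Longrightarrow> y \<in> A \<Longrightarrow> g x = g y \<Longrightarrow> h x = h y \<Longrightarrow> g' x = g' y"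
  shows "finite (g' ` A)" and "card (g' ` A) \<le> card (g ` A) * card C"
proof -
  define F where "F = (\<lambda>(u, v). g' (SOME x. x \<in> A \<and> g x = u \<and> h x = v))"
  have "g' x = F (g x, h x)" if "x \<in> A" for x
  proof -
    have "\<exists>y. y \<in> A \<and> g y = g x \<and> h y = h x" using that by blast
    from someI_ex[OF this] have "g' (SOME y. y \<in> A \<and> g y = g x \<and> h y = h x) = g' x"
      using that by (intro det) blast+
    then show ?thesis by (simp add: F_def)
  qed
  then have sub: "g' ` A \<subseteq> F ` (g ` A \<times> C)"
    using h by blast
  then show "finite (g' ` A)"
    using fin by (meson finite_SigmaI finite_imageI finite_subset)
  have "card (g' ` A) \<le> card (F ` (g ` A \<times> C))"
    using sub fin by (intro card_mono) auto
  also have "\<dots> \<le> card (g ` A \<times> C)"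
    using fin by (intro card_image_le) auto
  finally show "card (g' ` A) \<le> card (g ` A) * card C"
    by (simp add: card_cartesian_product)
qed

context nonautonomous_C1_maps
begin

text \<open>By injectivity on the branch, each critical point of \<open>f m\<close> has at most one
  preimage in it.\<close>

lemma
  fixes m :: nat and x :: real
  defines "F \<equiv> {a \<in> branch m x. itr f m a \<in> crit I0 Df m}"
  shows finite_branch_cuts: "finite F" and card_branch_cuts: "card F \<le> p"
proof -
  have inj: "inj_on (itr f m) F"
    by (rule inj_on_subset[OF inj_on_itr_branch[of m x]]) (auto simp: F_def)
  have sub: "itr f m ` F \<subseteq> crit I0 Df m" by (auto simp: F_def)
  show "finite F"
    using finite_imageD[OF finite_subset[OF sub finite_crit] inj] .
  show "card F \<le> p"
    using card_inj_on_le[OF inj sub finite_crit] card_crit le_trans by blast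
qed

text \<open>The number of cuts to the left of a point identifies its piece: for
  \<open>x \<le> y\<close> the two sets of cuts are nested and finite, so equal cardinality makes
  them equal and no cut separates \<open>x\<close> from \<open>y\<close>.\<close>

lemma branch_Suc_eqI:
  assumes xy: "x \<in> noncrit (Suc m)" "y \<in> noncrit (Suc m)" and br: "branch m x = branch m y"
    and cut: "card {a \<in> branch m x. itr f m a \<in> crit I0 Df m \<and> a < x} =
           card {a \<in> branch m y. itr f m a \<in> crit I0 Df m \<and> a < y}"
  shows "branch (Suc m) x = branch (Suc m) y"
  using assms
proof (induction x y rule: linorder_wlog)
  case (le x y)
  let ?C = "\<lambda>u. {a \<in> branch m x. itr f m a \<in> crit I0 Df m \<and> a < u}"
  have "finite (?C y)" by (rule finite_subset[OF _ finite_branch_cuts[of m x]]) auto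
  moreover have "?C x \<subseteq> ?C y" using \<open>x \<le> y\<close> by auto
  moreover have "card (?C x) = card (?C y)" using le.prems(3,4) by simp
  ultimately have C: "?C x = ?C y" by (rule card_subset_eq)
  have xym: "x \<in> noncrit m" "y \<in> noncrit m"
    and yc: "itr f m y \<notin> crit I0 Df m"
    using le.prems(1,2) by (simp_all add: noncrit_Suc)
  have "y \<in> branch m x" using self_in_branch[OF xym(2)] le.prems(3) by simp
  from closed_segment_subset_branch[OF self_in_branch[OF xym(1)] this]
  have seg: "{x..y} \<subseteq> branch m x"
    using \<open>x \<le> y\<close> by (simp add: closed_segment_eq_real_ivl1)
  have "{x..y} \<subseteq> noncrit (Suc m)"
  proof
    fix z assume z: "z \<in> {x..y}"
    then have zb: "z \<in> branch m x" using seg by blast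
    have "itr f m z \<notin> crit I0 Df m"
    proof
      assume c: "itr f m z \<in> crit I0 Df m"
      \<comment> \<open>\<open>?C y\<close> only records cuts strictly below \<open>y\<close>; that
        \<open>y\<close> is not a cut itself comes from
        \<open>y \<in> noncrit (Suc m)\<close>.\<close>
      then have "z \<noteq> y" using yc by blast
      then have "z \<in> ?C y" using z c zb by simp
      then have "z \<in> ?C x" using C by blast
      then show False using z by simp
    qed
    then show "z \<in> noncrit (Suc m)" using zb branch_subset noncrit_Suc by blast
  qed
  then show ?case
    using \<open>x \<le> y\<close> by (intro branch_eqI) (simp add: closed_segment_eq_real_ivl1)
next
  case (sym x y)
  show ?case using sym(1)[OF sym(3,2) sym(4)[symmetric] sym(5)[symmetric]] by simp
qed

text \<open>A branch has at most \<open>p\<close> cuts, so the number of cuts to the left of a point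
  takes one of the \<open>p + 1\<close> values in \<open>{..p}\<close>.\<close>

lemma card_branch_Suc:
  assumes A: "A \<subseteq> noncrit (Suc m)" and fin: "finite (branch m ` A)"
  shows "finite (branch (Suc m) ` A)"
    and "card (branch (Suc m) ` A) \<le> card (branch m ` A) * (p + 1)"
proof -
  define h where "h x = card {a \<in> branch m x. itr f m a \<in> crit I0 Df m \<and> a < x}" for x
  have h: "h x \<in> {..p}" for x
  proof -
    have "h x \<le> card {a \<in> branch m x. itr f m a \<in> crit I0 Df m}"
      unfolding h_def by (rule card_mono[OF finite_branch_cuts]) auto
    then show ?thesis using card_branch_cuts[of m x] by simp
  qed
  have det: "branch (Suc m) x = branch (Suc m) y"
    if "x \<in> A" "y \<in> A" "branch m x = branch m y" "h x = h y" for x y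
    using that A by (intro branch_Suc_eqI) (auto simp: h_def)
  show "finite (branch (Suc m) ` A)"
    by (rule card_image_le_mult_codes(1)[where h = h, OF fin finite_atMost]) (rule h, erule (3) det)
  have "card (branch (Suc m) ` A) \<le> card (branch m ` A) * card {..p}"
    by (rule card_image_le_mult_codes(2)[where h = h, OF fin finite_atMost]) (rule h, erule (3) det)
  then show "card (branch (Suc m) ` A) \<le> card (branch m ` A) * (p + 1)" by simp
qed

lemma card_branch_add:
  assumes "A \<subseteq> noncrit (m + k)" and "finite (branch m ` A)"
  shows "finite (branch (m + k) ` A) \<and>
    card (branch (m + k) ` A) \<le> card (branch m ` A) * (p + 1) ^ k"
  using assms(1)
proof (induction k)
  case (Suc k)
  then have A: "A \<subseteq> noncrit (Suc (m + k))" by simp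
  then have "A \<subseteq> noncrit (m + k)" using noncrit_Suc by blast
  note IH = Suc.IH[OF this]
  from card_branch_Suc[OF A conjunct1[OF IH]]
  have "finite (branch (Suc (m + k)) ` A)"
    "card (branch (Suc (m + k)) ` A) \<le> card (branch (m + k) ` A) * (p + 1)" by auto
  moreover have "card (branch (m + k) ` A) * (p + 1) \<le> card (branch m ` A) * (p + 1) ^ k * (p + 1)"
    using IH by (intro mult_right_mono) auto
  ultimately show ?case
    unfolding add_Suc_right power_Suc2 mult.assoc[symmetric] by linarith
qed (use assms in simp)

end

section \<open>Good blocks and the splitting of branches over them\<close>

text \<open>\<open>\<delta>\<close> is a modulus of continuity of all \<open>Df k\<close> for the
  threshold \<open>\<zeta>\<close>. The choice of \<open>\<sigma>\<close> keeps points that are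
  \<open>\<sigma>\<close>-close at the start of a block \<open>\<delta>\<close>-close throughout its
  \<open>N\<close> steps, since one step expands by at most \<open>\<Gamma>\<close>.\<close>

locale block_scales = nonautonomous_C1_maps +
  fixes N :: nat and \<zeta> \<delta> \<sigma> :: real
  assumes N_pos: "0 < N"
    and \<zeta>_pos: "0 < \<zeta>" and \<zeta>_less_1: "\<zeta> < 1"
    and \<sigma>_pos: "0 < \<sigma>"
    and Df_close: "\<And>k x y. x \<in> I0 \<Longrightarrow> y \<in> I0 \<Longrightarrow> \<bar>x - y\<bar> < \<delta> \<Longrightarrow> \<bar>Df k x - Df k y\<bar> < \<zeta>"
    and \<sigma>_le: "\<Gamma> ^ N * \<sigma> \<le> \<delta>"
begin

text \<open>The block starting at time 0 never counts as good: there a half branch may have infinite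
  length, to which \<open>len\<close> assigns 0, so a small \<open>rr\<close> would say
  nothing.\<close>

definition good :: "nat \<Rightarrow> real \<Rightarrow> bool" where
  "good m y \<longleftrightarrow> 0 < m \<and> rr I0 f Df m y < \<sigma> \<and> (\<forall>k<N. \<zeta> \<le> \<bar>Df (m + k) (itr f (m + k) y)\<bar>)"

text \<open>During the block the orbits of the segment stay \<open>\<delta>\<close>-close to that of
  \<open>y\<close>, so their derivatives differ by less than \<open>\<zeta>\<close> from numbers of
  modulus at least \<open>\<zeta>\<close> and cannot vanish.\<close>

lemma branch_eq_near:
  assumes y: "y \<in> noncrit m"
    and sub: "closed_segment x y \<subseteq> noncrit m"
    and near: "\<And>z. z \<in> closed_segment x y \<Longrightarrow> \<bar>itr f m z - itr f m y\<bar> < \<sigma>"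
    and big: "\<And>k. k < N \<Longrightarrow> \<zeta> \<le> \<bar>Df (m + k) (itr f (m + k) y)\<bar>"
  shows "branch (m + N) x = branch (m + N) y"
proof (rule branch_eqI, rule subsetI)
  fix z assume z: "z \<in> closed_segment x y"
  have I: "z \<in> I0" "y \<in> I0" using z sub y noncrit_subset by auto
  have "itr f (m + k) z \<notin> crit I0 Df (m + k)" if k: "k < N" for k
  proof -
    have "\<bar>itr f (m + k) z - itr f (m + k) y\<bar> \<le> \<Gamma> ^ k * \<bar>itr f m z - itr f m y\<bar>"
      by (rule itr_lipschitz[OF I])
    also have "\<dots> < \<Gamma> ^ k * \<sigma>"
      using near[OF z] \<Gamma>_gt_1 by simp
    also have "\<dots> \<le> \<Gamma> ^ N * \<sigma>"
      using k \<Gamma>_gt_1 \<sigma>_pos by (intro mult_right_mono power_increasing) auto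
    finally have "\<bar>itr f (m + k) z - itr f (m + k) y\<bar> < \<delta>" using \<sigma>_le by simp
    then have "\<bar>Df (m + k) (itr f (m + k) z) - Df (m + k) (itr f (m + k) y)\<bar> < \<zeta>"
      using I by (intro Df_close) auto
    then show ?thesis using big[OF k] by (auto simp: crit_def)
  qed
  moreover have "z \<in> noncrit m" using z sub by blast
  ultimately show "z \<in> noncrit (m + N)"
    by (auto simp: noncrit_def) (metis add_less_cancel_left le_Suc_ex not_le)
qed

text \<open>Between two points of one branch that are close to the same end of it, no cut occurs for
  \<open>N\<close> steps, so only the choice of the end matters.\<close>

lemma branch_good_eqI:
  assumes xy: "x \<in> noncrit m" "y \<in> noncrit m" and good: "good m x" "good m y"
    and br: "branch m x = branch m y"
    and side: "len (itr f m ` Lset I0 f Df m x) < \<sigma> \<longleftrightarrow> len (itr f m ` Lset I0 f Df m y) < \<sigma>"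
  shows "branch (m + N) x = branch (m + N) y"
  using assms
proof (induction x y rule: linorder_wlog)
  case (le x y)
  have m: "0 < m" using le.prems(3) by (simp add: good_def)
  have "y \<in> branch m x" using self_in_branch[OF le.prems(2)] le.prems(5) by simp
  from closed_segment_subset_branch[OF self_in_branch[OF le.prems(1)] this]
  have seg: "closed_segment x y \<subseteq> branch m x" .
  then have seg': "closed_segment x y \<subseteq> noncrit m" using branch_subset by blast
  have iv: "closed_segment x y = {x..y}" using \<open>x \<le> y\<close> by (rule closed_segment_eq_real_ivl1)
  show ?case
  proof (cases "len (itr f m ` Lset I0 f Df m y) < \<sigma>")
    case True
    show ?thesis
    proof (rule branch_eq_near[OF le.prems(2) seg'])
      fix z assume z: "z \<in> closed_segment x y"
      then have zb: "z \<in> branch m y" using seg le.prems(5) by blast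
      show "\<bar>itr f m z - itr f m y\<bar> < \<sigma>"
      proof (cases "z = y")
        case False
        then have "z < y" using z iv by simp
        from itr_dist_le_len(1)[OF m le.prems(2) zb this] True show ?thesis by simp
      qed (simp add: \<sigma>_pos)
    next
      show "\<zeta> \<le> \<bar>Df (m + k) (itr f (m + k) y)\<bar>" if "k < N" for k
        using le.prems(4) that by (simp add: good_def)
    qed
  next
    case False
    \<comment> \<open>By \<open>side\<close> the left length at \<open>x\<close> is not below
      \<open>\<sigma>\<close> either, so the minimum \<open>rr\<close> at \<open>x\<close> is
      attained on the right, which is the side of \<open>x\<close> that contains
      \<open>y\<close>.\<close>
    then have R: "len (itr f m ` Rset I0 f Df m x) < \<sigma>"
      using le.prems(3,6) by (auto simp: good_def rr_def)
    have "branch (m + N) y = branch (m + N) x"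
    proof (rule branch_eq_near[OF le.prems(1)])
      show "closed_segment y x \<subseteq> noncrit m"
        using seg' by (simp add: closed_segment_commute)
      fix z assume "z \<in> closed_segment y x"
      then have z: "z \<in> closed_segment x y" by (simp add: closed_segment_commute)
      then have zb: "z \<in> branch m x" using seg by blast
      show "\<bar>itr f m z - itr f m x\<bar> < \<sigma>"
      proof (cases "z = x")
        case False
        then have "x < z" using z iv by simp
        from itr_dist_le_len(2)[OF m le.prems(1) zb this] R show ?thesis by simp
      qed (simp add: \<sigma>_pos)
    next
      show "\<zeta> \<le> \<bar>Df (m + k) (itr f (m + k) x)\<bar>" if "k < N" for k
        using le.prems(3) that by (simp add: good_def)
    qed
    then show ?thesis by simp
  qed
next
  case (sym x y)
  show ?case using sym(1)[OF sym(3,2,5,4) sym(6)[symmetric] sym(7)[symmetric]] by simp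
qed

text \<open>\<open>S\<close> is the set of blocks that are allowed to be bad; it may contain good
  ones as well.\<close>

definition coded :: "nat \<Rightarrow> nat set \<Rightarrow> real set" where
  "coded q S = {x \<in> noncrit (q * N). \<forall>b<q. b \<notin> S \<longrightarrow> good (b * N) x}"

text \<open>Induction over blocks: a block in \<open>S\<close> multiplies the number of branches by
  at most \<open>(p + 1) ^ N\<close>, any other block by at most 2, the code being whether the left
  end is the close one.\<close>

lemma card_branch_coded:
  "finite (branch (q * N) ` coded q S) \<and>
   card (branch (q * N) ` coded q S) \<le> 2 ^ q * ((p + 1) ^ N) ^ card (S \<inter> {..<q})"
proof (induction q)
  case 0
  have "branch 0 x = I0" if "x \<in> I0" for x
    using that interval by (simp add: branch_eq_component noncrit_def is_interval_connected_1 connected_component_eq_self)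
  then have "branch (0 * N) ` coded 0 S \<subseteq> {I0}"
    by (auto simp: coded_def noncrit_def)
  then have "finite (branch (0 * N) ` coded 0 S)" "card (branch (0 * N) ` coded 0 S) \<le> card {I0}"
    by (auto intro: finite_subset simp del: card.insert intro!: card_mono)
  then show ?case by simp
next
  case (Suc q)
  let ?A = "coded (Suc q) S" and ?P = "(p + 1) ^ N"
  have eq: "Suc q * N = q * N + N" by simp
  have A: "?A \<subseteq> noncrit (q * N + N)" by (auto simp: coded_def add.commute)
  then have Am: "?A \<subseteq> noncrit (q * N)" using noncrit_antimono[of "q * N" "q * N + N"] by auto
  have sub: "branch (q * N) ` ?A \<subseteq> branch (q * N) ` coded q S"
    using Am by (intro image_mono) (auto simp: coded_def)
  then have fin: "finite (branch (q * N) ` ?A)"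
    using Suc.IH finite_subset by blast
  have le: "card (branch (q * N) ` ?A) \<le> 2 ^ q * ?P ^ card (S \<inter> {..<q})"
    using card_mono[OF _ sub] Suc.IH by (meson le_trans)
  show ?case
  proof (cases "q \<in> S")
    case True
    then have "S \<inter> {..<Suc q} = insert q (S \<inter> {..<q})" by auto
    then have c: "card (S \<inter> {..<Suc q}) = Suc (card (S \<inter> {..<q}))" by simp
    have "finite (branch (q * N + N) ` ?A)"
      "card (branch (q * N + N) ` ?A) \<le> card (branch (q * N) ` ?A) * ?P"
      using card_branch_add[OF A fin] by auto
    moreover have "card (branch (q * N) ` ?A) * ?P \<le> 2 ^ q * ?P ^ card (S \<inter> {..<q}) * ?P"
      using le by (rule mult_right_mono) simp
    moreover have "2 ^ q * ?P ^ card (S \<inter> {..<q}) * ?P \<le> 2 ^ Suc q * ?P ^ Suc (card (S \<inter> {..<q}))"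
      by (simp only: power_Suc2 mult.assoc mult_le_mono2 mult_le_mono)
    ultimately show ?thesis unfolding eq c by linarith
  next
    case False
    then have "S \<inter> {..<Suc q} = S \<inter> {..<q}" by (auto simp: less_Suc_eq)
    then have c: "card (S \<inter> {..<Suc q}) = card (S \<inter> {..<q})" by simp
    have det: "branch (q * N + N) x = branch (q * N + N) y"
      if "x \<in> ?A" "y \<in> ?A" "branch (q * N) x = branch (q * N) y"
        "(len (itr f (q * N) ` Lset I0 f Df (q * N) x) < \<sigma>) =
         (len (itr f (q * N) ` Lset I0 f Df (q * N) y) < \<sigma>)" for x y
    proof (rule branch_good_eqI[OF _ _ _ _ that(3,4)])
      show "x \<in> noncrit (q * N)" "y \<in> noncrit (q * N)" using that(1,2) Am by blast+
      show "good (q * N) x" "good (q * N) y" using that(1,2) False by (simp_all add: coded_def)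
    qed
    have "finite (branch (q * N + N) ` ?A)"
      "card (branch (q * N + N) ` ?A) \<le> card (branch (q * N) ` ?A) * card (UNIV :: bool set)"
      by (rule card_image_le_mult_codes[where h = "\<lambda>x. len (itr f (q * N) ` Lset I0 f Df (q * N) x) < \<sigma>",
          OF fin finite UNIV_I], erule (3) det)+
    moreover have "card (branch (q * N) ` ?A) * card (UNIV :: bool set)
        \<le> 2 ^ q * ?P ^ card (S \<inter> {..<q}) * card (UNIV :: bool set)"
      using le by (rule mult_right_mono) simp
    ultimately show ?thesis unfolding eq c by simp
  qed
qed

text \<open>A bad block is the first one, or contains a time from \<open>D\<close>, or has its index
  in \<open>R\<close>. These cases account for the summand 1 and for twice
  \<open>\<epsilon> * real (q * N)\<close>.\<close>

lemma card_not_good_le: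
  assumes x: "x \<in> I0"
    and \<epsilon>: "ln \<Gamma> \<le> \<epsilon> * ln (1 / \<zeta>)"
    and exp: "1 \<le> \<bar>Dn f Df (q * N) x\<bar>"
    and small: "(\<Sum>i=1..q * N. rr I0 f Df i x) \<le> \<sigma> * \<epsilon> * real (q * N)"
  shows "real (card {b. b < q \<and> \<not> good (b * N) x}) \<le> 1 + 2 * \<epsilon> * real (q * N)"
proof -
  let ?n = "q * N"
  define D where "D = {j. j < ?n \<and> \<bar>Df j (itr f j x)\<bar> < \<zeta>}"
  define R where "R = {b. 0 < b \<and> b < q \<and> \<sigma> \<le> rr I0 f Df (b * N) x}"
  have fin: "finite D" "finite R" by (simp_all add: D_def R_def)
  have sub: "{b. b < q \<and> \<not> good (b * N) x} \<subseteq> insert 0 ((\<lambda>j. j div N) ` D \<union> R)"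
  proof
    fix b assume "b \<in> {b. b < q \<and> \<not> good (b * N) x}"
    then have b: "b < q" "\<not> good (b * N) x" by auto
    show "b \<in> insert 0 ((\<lambda>j. j div N) ` D \<union> R)"
    proof (cases "b = 0 \<or> \<sigma> \<le> rr I0 f Df (b * N) x")
      case True
      with b show ?thesis by (auto simp: R_def)
    next
      case False
      then obtain k where k: "k < N" "\<bar>Df (b * N + k) (itr f (b * N + k) x)\<bar> < \<zeta>"
        using b N_pos unfolding good_def by force
      have "b * N + k < (b + 1) * N" using k by simp
      also have "\<dots> \<le> ?n" using b by (intro mult_le_mono1) simp
      finally have "b * N + k \<in> D" using k by (simp add: D_def)
      moreover have "b = (b * N + k) div N" using k by simp
      ultimately show ?thesis by blast
    qed
  qed
  have "card {b. b < q \<and> \<not> good (b * N) x} \<le> card (insert 0 ((\<lambda>j. j div N) ` D \<union> R))"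
    using sub fin by (intro card_mono) auto
  also have "\<dots> \<le> Suc (card ((\<lambda>j. j div N) ` D \<union> R))"
    by (rule card_insert_le_m1) auto
  also have "\<dots> \<le> Suc (card ((\<lambda>j. j div N) ` D) + card R)"
    using card_Un_le by simp
  also have "\<dots> \<le> Suc (card D + card R)"
    using card_image_le[OF fin(1)] by simp
  finally have card: "real (card {b. b < q \<and> \<not> good (b * N) x}) \<le> 1 + real (card D) + real (card R)"
    by linarith

  have l\<zeta>: "ln (1 / \<zeta>) > 0" using \<zeta>_pos \<zeta>_less_1 by simp
  \<comment> \<open>Every factor is at most \<open>\<Gamma>\<close>, and at most
    \<open>\<Gamma> * \<zeta>\<close> at times in \<open>D\<close>. A product of at least 1
    therefore forces \<open>\<Gamma> ^ ?n * \<zeta> ^ card D\<close> to be at least 1, which bounds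
    \<open>card D\<close> after taking logarithms.\<close>
  have "1 \<le> (\<Prod>j<?n. \<bar>Df j (itr f j x)\<bar>)"
    using exp by (simp add: Dn_def abs_prod)
  also have "\<dots> \<le> (\<Prod>j<?n. \<Gamma> * (if j \<in> D then \<zeta> else 1))"
  proof (rule prod_mono)
    fix j assume j: "j \<in> {..<?n}"
    have "\<zeta> \<le> \<Gamma> * \<zeta>" using \<Gamma>_gt_1 \<zeta>_pos by simp
    then show "0 \<le> \<bar>Df j (itr f j x)\<bar> \<and> \<bar>Df j (itr f j x)\<bar> \<le> \<Gamma> * (if j \<in> D then \<zeta> else 1)"
      using j Df_bound[of "itr f j x" j] x by (auto simp: D_def)
  qed
  also have "\<dots> = \<Gamma> ^ ?n * \<zeta> ^ card ({..<?n} \<inter> D)"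
    by (simp add: prod.distrib prod.If_cases)
  also have "{..<?n} \<inter> D = D" by (auto simp: D_def)
  finally have "ln 1 \<le> ln (\<Gamma> ^ ?n * \<zeta> ^ card D)"
    using \<Gamma>_gt_1 \<zeta>_pos by (subst ln_le_cancel_iff) auto
  then have "real (card D) * ln (1 / \<zeta>) \<le> real ?n * ln \<Gamma>"
    using \<Gamma>_gt_1 \<zeta>_pos by (simp add: ln_mult ln_realpow ln_div)
  also have "\<dots> \<le> real ?n * (\<epsilon> * ln (1 / \<zeta>))"
    using \<epsilon> by (intro mult_left_mono) auto
  finally have D: "real (card D) \<le> \<epsilon> * real ?n"
    using l\<zeta> by (metis mult.assoc mult.commute mult_le_cancel_right_pos)

  \<comment> \<open>Markov's inequality: the times \<open>b * N\<close> with \<open>b\<close> in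
    \<open>R\<close> are distinct indices of the sum, at least 1 because \<open>0 < b\<close>, and
    each contributes at least \<open>\<sigma>\<close>.\<close>
  have "real (card R) * \<sigma> \<le> (\<Sum>b\<in>R. rr I0 f Df (b * N) x)"
    using sum_mono[of R "\<lambda>_. \<sigma>" "\<lambda>b. rr I0 f Df (b * N) x"] by (simp add: R_def)
  also have "\<dots> = (\<Sum>i\<in>(\<lambda>b. b * N) ` R. rr I0 f Df i x)"
    using N_pos by (subst sum.reindex) (auto simp: inj_on_def)
  also have "\<dots> \<le> (\<Sum>i=1..?n. rr I0 f Df i x)"
    using N_pos by (intro sum_mono2) (auto simp: R_def rr_nonneg Suc_le_eq)
  also note small
  finally have "real (card R) * \<sigma> \<le> (\<epsilon> * real ?n) * \<sigma>" by (simp add: mult_ac)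
  then have R: "real (card R) \<le> \<epsilon> * real ?n"
    using \<sigma>_pos by simp
  show ?thesis using card D R by simp
qed

section \<open>Measure of the exceptional sets and the Borel-Cantelli argument\<close>

text \<open>Whole branches meeting \<open>coded q S\<close> are taken, not just the coded points.
  Hence measurability of the cover requires none of \<open>rr\<close>.\<close>

definition cover :: "nat \<Rightarrow> real \<Rightarrow> real \<Rightarrow> real set" where
  "cover q \<kappa> K = (\<Union>S\<in>{S. S \<subseteq> {..<q} \<and> real (card S) \<le> \<kappa>}.
     \<Union>T\<in>branch (q * N) ` coded q S. {y \<in> T. K \<le> \<bar>Dn f Df (q * N) y\<bar>})"

text \<open>There are at most \<open>2 ^ q\<close> sets \<open>S\<close>, and each leads to at most
  \<open>2 ^ q\<close> times \<open>(real (p + 1) ^ N) powr \<kappa>\<close> branches, whose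
  expanding parts have measure at most \<open>2 * \<Gamma> / K\<close>.\<close>

lemma
  assumes q: "0 < q" and K: "K > 0"
  shows cover_lmeasurable: "cover q \<kappa> K \<in> lmeasurable"
    and measure_cover_le:
      "measure lebesgue (cover q \<kappa> K) \<le> 4 ^ q * (real (p + 1) ^ N) powr \<kappa> * (2 * \<Gamma> / K)"
proof -
  let ?I = "{S. S \<subseteq> {..<q} \<and> real (card S) \<le> \<kappa>}"
  let ?E = "\<lambda>T. {y \<in> T. K \<le> \<bar>Dn f Df (q * N) y\<bar>}"
  let ?P = "real (p + 1) ^ N"
  have m: "0 < q * N" using q N_pos by simp
  have I: "?I \<subseteq> Pow {..<q}" by auto
  then have finI: "finite ?I" by (rule finite_subset) simp
  have finB: "finite (branch (q * N) ` coded q S)" for S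
    using card_branch_coded by blast
  have E: "?E T \<in> lmeasurable" "measure lebesgue (?E T) \<le> 2 * \<Gamma> / K"
    if T: "T \<in> branch (q * N) ` coded q S" for S T
  proof -
    from T obtain x where "T = branch (q * N) x" by blast
    then show "?E T \<in> lmeasurable" "measure lebesgue (?E T) \<le> 2 * \<Gamma> / K"
      using measure_branch_expanding[OF m K] by simp_all
  qed
  have U: "(\<Union>T\<in>branch (q * N) ` coded q S. ?E T) \<in> lmeasurable" for S
    using finB E(1) by (rule fmeasurable.finite_UN)
  show "cover q \<kappa> K \<in> lmeasurable"
    unfolding cover_def using finI U by (rule fmeasurable.finite_UN)
  have "measure lebesgue (\<Union>T\<in>branch (q * N) ` coded q S. ?E T) \<le> 2 ^ q * ?P powr \<kappa> * (2 * \<Gamma> / K)"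
    if S: "S \<in> ?I" for S
  proof -
    have "measure lebesgue (\<Union>T\<in>branch (q * N) ` coded q S. ?E T)
        \<le> (\<Sum>T\<in>branch (q * N) ` coded q S. measure lebesgue (?E T))"
      using finB E(1) by (intro measure_UNION_le) (auto intro: fmeasurableD)
    also have "\<dots> \<le> real (card (branch (q * N) ` coded q S)) * (2 * \<Gamma> / K)"
      by (rule sum_bounded_above) (rule E(2))
    also have "\<dots> \<le> (2 ^ q * ?P powr \<kappa>) * (2 * \<Gamma> / K)"
    proof (rule mult_right_mono)
      have "real (card (branch (q * N) ` coded q S)) \<le> real (2 ^ q * ((p + 1) ^ N) ^ card (S \<inter> {..<q}))"
        using card_branch_coded[of q S] of_nat_mono by blast
      also have "\<dots> = 2 ^ q * ?P powr real (card S)"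
        using S by (simp add: powr_realpow Int_absorb2)
      also have "\<dots> \<le> 2 ^ q * ?P powr \<kappa>"
        using S by (intro mult_left_mono powr_mono) auto
      finally show "real (card (branch (q * N) ` coded q S)) \<le> 2 ^ q * ?P powr \<kappa>" .
    qed (use K \<Gamma>_gt_1 in simp)
    finally show ?thesis .
  qed
  note S = this
  have "measure lebesgue (cover q \<kappa> K)
      \<le> (\<Sum>S\<in>?I. measure lebesgue (\<Union>T\<in>branch (q * N) ` coded q S. ?E T))"
    unfolding cover_def using finI U by (intro measure_UNION_le) (auto intro: fmeasurableD)
  also have "\<dots> \<le> real (card ?I) * (2 ^ q * ?P powr \<kappa> * (2 * \<Gamma> / K))"
    by (rule sum_bounded_above) (rule S)
  also have "\<dots> \<le> 2 ^ q * (2 ^ q * ?P powr \<kappa> * (2 * \<Gamma> / K))"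
  proof (rule mult_right_mono)
    have "card ?I \<le> card (Pow {..<q})" using I by (intro card_mono) auto
    then show "real (card ?I) \<le> 2 ^ q"
      by (metis card_Pow card_lessThan finite_lessThan of_nat_le_iff of_nat_numeral of_nat_power)
  qed (use K \<Gamma>_gt_1 in simp)
  also have "\<dots> = 4 ^ q * ?P powr \<kappa> * (2 * \<Gamma> / K)"
    by (simp flip: power_mult_distrib mult.assoc)
  finally show "measure lebesgue (cover q \<kappa> K) \<le> 4 ^ q * ?P powr \<kappa> * (2 * \<Gamma> / K)" .
qed

lemma in_coverI:
  assumes x: "x \<in> I0" and K: "1 \<le> K" "K \<le> \<bar>Dn f Df (q * N) x\<bar>"
    and \<epsilon>: "ln \<Gamma> \<le> \<epsilon> * ln (1 / \<zeta>)"
    and small: "(\<Sum>i=1..q * N. rr I0 f Df i x) \<le> \<sigma> * \<epsilon> * real (q * N)"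
  shows "x \<in> cover q (1 + 2 * \<epsilon> * real (q * N)) K"
proof -
  define S where "S = {b. b < q \<and> \<not> good (b * N) x}"
  have nc: "x \<in> noncrit (q * N)" using x K by (auto simp: noncrit_iff)
  then have "x \<in> coded q S" by (auto simp: coded_def S_def)
  moreover have "real (card S) \<le> 1 + 2 * \<epsilon> * real (q * N)"
    unfolding S_def using K by (intro card_not_good_le[OF x \<epsilon> _ small]) simp
  moreover have "S \<subseteq> {..<q}" by (auto simp: S_def)
  moreover have "x \<in> branch (q * N) x" using nc by (rule self_in_branch)
  ultimately show ?thesis using K unfolding cover_def by blast
qed

text \<open>Assumption \<open>N\<close> keeps the growth of the number of branches below
  \<open>exp (lam * real (q * N))\<close> up to a constant, while expansion yields the factor
  \<open>exp (- 2 * lam * real (q * N))\<close>. The covers thus have summable measure, and almost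
  every point is eventually outside them; an expanding point with a small sum would be
  inside.\<close>

lemma AE_eventually_sum_rr:
  fixes \<epsilon> lam :: real
  assumes lam: "0 < lam"
    and \<epsilon>: "0 < \<epsilon>" "ln \<Gamma> \<le> \<epsilon> * ln (1 / \<zeta>)"
    and N: "ln 4 + 2 * \<epsilon> * real N * (real N * ln (real (p + 1))) \<le> lam * real N"
  shows "AE x in lebesgue. x \<in> I0 \<longrightarrow>
    (\<forall>\<^sub>F n in sequentially. exp (2 * lam * real n) \<le> \<bar>Dn f Df n x\<bar>) \<longrightarrow>
    (\<forall>\<^sub>F q in sequentially. \<sigma> * \<epsilon> * real (q * N) \<le> (\<Sum>i=1..q * N. rr I0 f Df i x))"
proof -
  define l where "l = real N * ln (real (p + 1))"
  define E where "E q = cover q (1 + 2 * \<epsilon> * real (q * N)) (exp (2 * lam * real (q * N)))" for q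
  \<comment> \<open>The index is shifted to \<open>Suc q\<close> because the bounds on the covers
    hold for positive \<open>q\<close> only; the shift is undone in the final step.\<close>
  have E: "E (Suc q) \<in> lmeasurable" for q
    unfolding E_def by (rule cover_lmeasurable) auto
  have P: "(real (p + 1) ^ N) powr \<kappa> = exp (\<kappa> * l)" for \<kappa>
    by (simp add: powr_def ln_realpow l_def mult.assoc)
  have bound: "measure lebesgue (E q) \<le> 2 * \<Gamma> * exp l * exp (- lam * real N) ^ q"
    if q: "0 < q" for q
  proof -
    have "measure lebesgue (E q) \<le> 4 ^ q * exp ((1 + 2 * \<epsilon> * real (q * N)) * l)
        * (2 * \<Gamma> / exp (2 * lam * real (q * N)))"
      unfolding E_def P[symmetric] by (rule measure_cover_le[OF q]) simp
    also have "\<dots> = 2 * \<Gamma> * exp (real q * ln 4 + (1 + 2 * \<epsilon> * real (q * N)) * l - 2 * lam * real (q * N))"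
      by (simp add: exp_add exp_diff exp_of_nat_mult)
    also have "\<dots> \<le> 2 * \<Gamma> * exp (l + real q * (- lam * real N))"
    proof -
      have "real q * (ln 4 + 2 * \<epsilon> * real N * l) \<le> real q * (lam * real N)"
        using N by (intro mult_left_mono) (auto simp: l_def)
      then show ?thesis
        using \<Gamma>_gt_1 by (intro mult_left_mono) (auto simp: algebra_simps)
    qed
    also have "\<dots> = 2 * \<Gamma> * exp l * exp (- lam * real N) ^ q"
      by (simp only: exp_add exp_of_nat_mult mult.assoc)
    finally show ?thesis .
  qed
  have r: "exp (- lam * real N) < 1" using lam N_pos by simp
  have "summable (\<lambda>q. measure lebesgue (E (Suc q)))"
  proof (rule summable_comparison_test')
    show "summable (\<lambda>q. 2 * \<Gamma> * exp l * exp (- lam * real N) ^ Suc q)"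
      using r by (intro summable_mult summable_ignore_initial_segment[of _ 1, simplified] summable_geometric) simp
    show "norm (measure lebesgue (E (Suc q))) \<le> 2 * \<Gamma> * exp l * exp (- lam * real N) ^ Suc q" for q
      using bound[of "Suc q"] by simp
  qed
  then have "AE x in lebesgue. eventually (\<lambda>q. x \<in> space lebesgue - E (Suc q)) sequentially"
    using fmeasurableD[OF E] fmeasurableD2[OF E]
    by (intro borel_cantelli_AE1) (simp_all add: less_top del: emeasure_completion)
  then show ?thesis
  proof (rule AE_mp, intro AE_I2 impI)
    fix x
    assume ev: "\<forall>\<^sub>F q in sequentially. x \<in> space lebesgue - E (Suc q)"
      and x: "x \<in> I0"
      and exp: "\<forall>\<^sub>F n in sequentially. exp (2 * lam * real n) \<le> \<bar>Dn f Df n x\<bar>"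
    from ev have "\<forall>\<^sub>F q in sequentially. x \<notin> E (Suc q)"
      by (rule eventually_mono) simp
    then have ev': "\<forall>\<^sub>F q in sequentially. x \<notin> E q"
      by (subst (asm) eventually_sequentially_Suc)
    have "filterlim (\<lambda>q. q * N) sequentially sequentially"
      using N_pos by (intro filterlim_subseq) (auto simp: strict_mono_def)
    from filterlim_iff[THEN iffD1, OF this, rule_format, OF exp] ev'
    show "\<forall>\<^sub>F q in sequentially. \<sigma> * \<epsilon> * real (q * N) \<le> (\<Sum>i=1..q * N. rr I0 f Df i x)"
    proof eventually_elim
      case (elim q)
      show ?case
      proof (rule ccontr)
        assume "\<not> ?thesis"
        then have "x \<in> E q"
          unfolding E_def using elim(1) lam by (intro in_coverI[OF x _ _ \<epsilon>(2)]) auto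
        with elim(2) show False ..
      qed
    qed
  qed
qed

end

section \<open>From multiples of the block length to the lower limits\<close>

text \<open>For \<open>q = n div N\<close> with \<open>q \<ge> 1\<close> one has
  \<open>q * N \<le> n \<le> 2 * (q * N)\<close>. As the terms are nonnegative, passing from
  \<open>q * N\<close> to \<open>n\<close> loses at most the factor 2.\<close>

lemma liminf_average_ge_of_multiples:
  fixes a :: "nat \<Rightarrow> real"
  assumes nonneg: "\<And>i. 0 \<le> a i" and c: "0 \<le> c" and N: "0 < N"
    and ev: "\<forall>\<^sub>F q in sequentially. c * real (q * N) \<le> (\<Sum>i=1..q * N. a i)"
  shows "ereal (c / 2) \<le> liminf (\<lambda>n. ereal ((\<Sum>i=1..n. a i) / real n))"
proof (rule Liminf_bounded)
  from ev obtain q0 where q0: "\<And>q. q0 \<le> q \<Longrightarrow> c * real (q * N) \<le> (\<Sum>i=1..q * N. a i)"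
    by (auto simp: eventually_sequentially)
  show "\<forall>\<^sub>F n in sequentially. ereal (c / 2) \<le> ereal ((\<Sum>i=1..n. a i) / real n)"
  proof (rule eventually_sequentiallyI)
    fix n assume n: "(q0 + 1) * N \<le> n"
    define q where "q = n div N"
    have q: "q0 + 1 \<le> q" using n N by (simp add: q_def less_eq_div_iff_mult_less_eq)
    have n0: "0 < n" using n N by (meson add_gr_0 less_le_trans mult_pos_pos zero_less_one)
    have "n = q * N + n mod N" by (simp add: q_def)
    moreover have "n mod N < N" using N by simp
    moreover have "N \<le> q * N" using q by (cases q) auto
    ultimately have le: "q * N \<le> n" "n \<le> 2 * (q * N)" by linarith+
    have "c * (real n / 2) \<le> c * real (q * N)"
      using c le(2) by (intro mult_left_mono) (auto simp del: of_nat_mult)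
    also have "\<dots> \<le> (\<Sum>i=1..q * N. a i)" using q by (intro q0) simp
    also have "\<dots> \<le> (\<Sum>i=1..n. a i)"
      using le(1) nonneg by (intro sum_mono2) auto
    finally show "ereal (c / 2) \<le> ereal ((\<Sum>i=1..n. a i) / real n)"
      using n0 by (simp add: field_simps)
  qed
qed

lemma eventually_exp_le_of_liminf:
  fixes D :: "nat \<Rightarrow> real"
  assumes "ereal l < liminf (\<lambda>n. ereal (ln \<bar>D n\<bar> / real n))" and l: "0 \<le> l"
  shows "\<forall>\<^sub>F n in sequentially. exp (l * real n) \<le> \<bar>D n\<bar>"
  using less_LiminfD[OF assms(1)] eventually_gt_at_top[of 0]
proof eventually_elim
  case (elim n)
  then have less: "l * real n < ln \<bar>D n\<bar>" by (simp add: field_simps)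
  \<comment> \<open>\<open>ln 0 = 0\<close>, so a vanishing derivative is excluded by \<open>0 \<le> l\<close>.\<close>
  then have "D n \<noteq> 0" using l by (cases "D n = 0") (auto simp: mult_less_0_iff)
  with less show ?case
    using ln_ge_iff[of "\<bar>D n\<bar>" "l * real n"] by simp
qed

section \<open>Choice of the constants and conclusion\<close>

theorem theoremB:
  fixes I0 :: "real set" and f Df :: "nat \<Rightarrow> real \<Rightarrow> real" and H :: "real set" and lam :: real
  assumes interval: "is_interval I0"
    and maps: "\<And>k x. x \<in> I0 \<Longrightarrow> f k x \<in> I0"
    and deriv: "\<And>k x. x \<in> I0 \<Longrightarrow> (f k has_real_derivative Df k x) (at x within I0)"
    and C1: "\<And>k. continuous_on I0 (Df k)"
    and equicont: "\<forall>\<zeta>>0. \<exists>\<epsilon>>0. \<forall>k. \<forall>x\<in>I0. \<forall>y\<in>I0. \<bar>x - y\<bar> < \<epsilon> \<longrightarrow>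
                      \<bar>f k x - f k y\<bar> < \<zeta> \<and> \<bar>Df k x - Df k y\<bar> < \<zeta>"
    and bdd: "\<exists>\<Gamma>>0. \<forall>k. \<forall>x\<in>I0. \<bar>f k x\<bar> \<le> \<Gamma> \<and> \<bar>Df k x\<bar> \<le> \<Gamma>"
    and crit_bdd: "\<exists>p::nat. \<forall>k. finite (crit I0 Df k) \<and> card (crit I0 Df k) \<le> p"
    and lam: "lam > 0"
    and HI: "H \<subseteq> I0"
    and Hexp: "\<And>x. x \<in> H \<Longrightarrow>
        liminf (\<lambda>n. ereal (ln \<bar>Dn f Df n x\<bar> / real n)) > ereal (2 * lam)"
  shows "\<exists>c>0. AE x in lebesgue. x \<in> H \<longrightarrow>
           liminf (\<lambda>n. ereal ((\<Sum>i=1..n. rr I0 f Df i x) / real n)) \<ge> ereal c"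
proof -
  from bdd obtain \<Gamma>0 where \<Gamma>0: "\<And>k x. x \<in> I0 \<Longrightarrow> \<bar>f k x\<bar> \<le> \<Gamma>0 \<and> \<bar>Df k x\<bar> \<le> \<Gamma>0"
    by blast
  from crit_bdd obtain p where p: "\<And>k. finite (crit I0 Df k)" "\<And>k. card (crit I0 Df k) \<le> p"
    by blast
  define \<Gamma> where "\<Gamma> = max \<Gamma>0 2"
  have \<Gamma>: "1 < \<Gamma>" "0 < ln \<Gamma>" by (simp_all add: \<Gamma>_def less_max_iff_disj)
  interpret nonautonomous_C1_maps I0 f Df \<Gamma> p
    by standard (use interval maps deriv C1 \<Gamma>0 p \<Gamma> in \<open>auto simp: \<Gamma>_def le_max_iff_disj\<close>)

  \<comment> \<open>\<open>N\<close> is so large that \<open>ln 4\<close> uses up at most half of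
    the budget \<open>lam * real N\<close>; the passage to \<open>Suc N\<close> makes it
    positive.\<close>
  obtain N where N: "2 * ln 4 / lam \<le> real N" "0 < N"
  proof -
    obtain N where "2 * ln 4 / lam \<le> real N" using real_arch_simple by blast
    then have "2 * ln 4 / lam \<le> real (Suc N)" by simp
    then show thesis using that by blast
  qed
  define l where "l = ln (real (p + 1))"
  have l: "0 \<le> l" by (simp add: l_def)
  \<comment> \<open>The bad blocks get the other half of the budget. The denominator contains
    \<open>l + 1\<close> because \<open>l\<close> is 0 when \<open>p = 0\<close>.\<close>
  define \<epsilon> where "\<epsilon> = lam / (4 * real N * (l + 1))"
  have \<epsilon>: "0 < \<epsilon>" using lam N l by (simp add: \<epsilon>_def)
  have budget: "ln 4 + 2 * \<epsilon> * real N * (real N * l) \<le> lam * real N"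
  proof -
    have "ln 4 \<le> lam * real N / 2" using N(1) lam by (simp add: field_simps)
    moreover have "2 * (lam / (4 * real N * L)) * real N * (real N * l) = lam * real N / 2 * (l / L)"
      if "0 < L" for L
      using N that by (simp add: field_simps)
    from this[of "l + 1"] have "2 * \<epsilon> * real N * (real N * l) = lam * real N / 2 * (l / (l + 1))"
      using l by (simp add: \<epsilon>_def)
    moreover have "lam * real N / 2 * (l / (l + 1)) \<le> lam * real N / 2 * 1"
      using lam l by (intro mult_left_mono) auto
    ultimately show ?thesis by linarith
  qed
  \<comment> \<open>This solves \<open>ln \<Gamma> = \<epsilon> * ln (1 / \<zeta>)\<close>.\<close>
  define \<zeta> where "\<zeta> = exp (- (ln \<Gamma> / \<epsilon>))"
  have \<zeta>: "0 < \<zeta>" "\<zeta> < 1" "ln \<Gamma> \<le> \<epsilon> * ln (1 / \<zeta>)"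
    using \<Gamma> \<epsilon> by (simp_all add: \<zeta>_def ln_div)
  from equicont \<zeta>(1) obtain \<delta> where \<delta>: "0 < \<delta>"
    "\<And>k x y. x \<in> I0 \<Longrightarrow> y \<in> I0 \<Longrightarrow> \<bar>x - y\<bar> < \<delta> \<Longrightarrow> \<bar>Df k x - Df k y\<bar> < \<zeta>"
    by meson
  define \<sigma> where "\<sigma> = \<delta> / \<Gamma> ^ N"
  have \<sigma>: "0 < \<sigma>" "\<Gamma> ^ N * \<sigma> \<le> \<delta>" using \<delta>(1) \<Gamma> by (simp_all add: \<sigma>_def)
  interpret block_scales I0 f Df \<Gamma> p N \<zeta> \<delta> \<sigma>
    by standard (use N \<zeta> \<delta> \<sigma> in auto)

  \<comment> \<open>The constant \<open>\<sigma> * \<epsilon> / 2\<close> is independent of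
    \<open>x\<close>: \<open>N\<close>, \<open>\<epsilon>\<close>, \<open>\<zeta>\<close>,
    \<open>\<delta>\<close> and \<open>\<sigma>\<close> were fixed in this order from
    \<open>lam\<close>, \<open>p\<close>, \<open>\<Gamma>\<close> and the modulus of
    equicontinuity.\<close>
  have "AE x in lebesgue. x \<in> H \<longrightarrow>
      ereal (\<sigma> * \<epsilon> / 2) \<le> liminf (\<lambda>n. ereal ((\<Sum>i=1..n. rr I0 f Df i x) / real n))"
    using AE_eventually_sum_rr[OF lam \<epsilon> \<zeta>(3) budget[unfolded l_def]]
  proof (rule AE_mp, intro AE_I2 impI)
    fix x
    assume ae: "x \<in> I0 \<longrightarrow>
        (\<forall>\<^sub>F n in sequentially. exp (2 * lam * real n) \<le> \<bar>Dn f Df n x\<bar>) \<longrightarrow>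
        (\<forall>\<^sub>F q in sequentially. \<sigma> * \<epsilon> * real (q * N) \<le> (\<Sum>i=1..q * N. rr I0 f Df i x))"
      and x: "x \<in> H"
    have "\<forall>\<^sub>F n in sequentially. exp (2 * lam * real n) \<le> \<bar>Dn f Df n x\<bar>"
      using Hexp[OF x] lam by (intro eventually_exp_le_of_liminf) auto
    with ae x HI have "\<forall>\<^sub>F q in sequentially. \<sigma> * \<epsilon> * real (q * N) \<le> (\<Sum>i=1..q * N. rr I0 f Df i x)"
      by blast
    then show "ereal (\<sigma> * \<epsilon> / 2) \<le> liminf (\<lambda>n. ereal ((\<Sum>i=1..n. rr I0 f Df i x) / real n))"
      using \<sigma> \<epsilon> N by (intro liminf_average_ge_of_multiples rr_nonneg) auto
  qed
  moreover have "0 < \<sigma> * \<epsilon> / 2" using \<sigma> \<epsilon> by simp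
  ultimately show ?thesis by blast
qed

end
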